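(* There exists a Tonelli Lagrangian $L:T\mathbb{T}^2\to\mathbb{R}$ on the 2-torus, with energy function $E$, such that $e_0(L)>\min E$ and, for all energy values $k>\min E$ sufficiently close to $\min E$, the Lagrangian system of $L$ possesses only two periodic orbits with energy $k$ (up to time-shift and iteration), and none of these orbits is a local minimizer of the free-period action functional $\mathcal{S}_k$.
   Context: A Tonelli Lagrangian on a closed manifold $M$ is a smooth function $L:TM\to\mathbb{R}$ whose restriction to every fiber of $TM$ is superlinear and has everywhere positive-definite Hessian. Its Lagrangian system is given by the solutions $\gamma$ of the Euler-Lagrange equation $\frac{d}{dt}L_v(\gamma,\dot\gamma)-L_q(\gamma,\dot\gamma)=0$. The energy is $E(q,v)=L_v(q,v)v-L(q,v)$, and $e_0(L)=\max_{q\in M}E(q,0)$. A periodic orbit with energy $k$ is a periodic solution with $E(\gamma,\dot\gamma)\equiv k$. The free-period action functional is $\mathcal{S}_k(\Gamma,\tau)=\tau\int_0^1[L(\Gamma(t),\dot\Gamma(t)/\tau)+k]\,dt$ on $W^{1,2}(\mathbb{R}/\mathbb{Z},M)\times(0,\infty)$, where $(\Gamma,\tau)$ is identified with the $\tau$-periodic curve $\gamma(t)=\Gamma(t/\tau)$. *)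

theory Defs
  imports "HOL-Analysis.Analysis"
begin

text \<open>
  The torus is $\mathbb{R}^2/\mathbb{Z}^2$, with tangent bundle
  $\mathbb{T}^2 \times \mathbb{R}^2$. Functions on the tangent bundle are functions of
  \<open>(q, v)\<close> that are lattice-periodic in \<open>q\<close>; curves in the torus are represented by their
  lifts to the plane, which are unique up to a lattice translation.
\<close>

definition lattice :: "(real^2) set" where
  "lattice = {m. \<forall>i. m $ i \<in> \<int>}"

primrec C_k :: "nat \<Rightarrow> ('a::real_normed_vector \<Rightarrow> 'b::real_normed_vector) \<Rightarrow> bool" where
  "C_k 0 f \<longleftrightarrow> continuous_on UNIV f"
| "C_k (Suc n) f \<longleftrightarrow>
     (\<forall>x. f differentiable (at x)) \<and> (\<forall>u. C_k n (\<lambda>x. frechet_derivative f (at x) u))"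

definition smooth :: "('a::real_normed_vector \<Rightarrow> 'b::real_normed_vector) \<Rightarrow> bool" where
  "smooth f \<longleftrightarrow> (\<forall>n. C_k n f)"

type_synonym lagrangian = "real^2 \<Rightarrow> real^2 \<Rightarrow> real"

definition L_q :: "lagrangian \<Rightarrow> real^2 \<Rightarrow> real^2 \<Rightarrow> real^2 \<Rightarrow> real" where
  "L_q L q v = frechet_derivative (\<lambda>x. L x v) (at q)"

definition L_v :: "lagrangian \<Rightarrow> real^2 \<Rightarrow> real^2 \<Rightarrow> real^2 \<Rightarrow> real" where
  "L_v L q v = frechet_derivative (L q) (at v)"

definition L_vv :: "lagrangian \<Rightarrow> real^2 \<Rightarrow> real^2 \<Rightarrow> real^2 \<Rightarrow> real^2 \<Rightarrow> real" where
  "L_vv L q v u w = frechet_derivative (\<lambda>y. L_v L q y u) (at v) w"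

definition tonelli :: "lagrangian \<Rightarrow> bool" where
  "tonelli L \<longleftrightarrow>
     smooth (\<lambda>(q, v). L q v) \<and>
     (\<forall>q v. \<forall>m\<in>lattice. L (q + m) v = L q v) \<and>
     (\<forall>q. filterlim (\<lambda>v. L q v / norm v) at_top at_infinity) \<and>
     (\<forall>q v u. u \<noteq> 0 \<longrightarrow> L_vv L q v u u > 0)"

definition energy :: "lagrangian \<Rightarrow> real^2 \<Rightarrow> real^2 \<Rightarrow> real" where
  "energy L q v = L_v L q v v - L q v"

text \<open>
  For a Tonelli Lagrangian the supremum and the infimum below are attained: the base is
  compact, and on each fibre the energy is smallest at the zero vector.
\<close>

definition e0 :: "lagrangian \<Rightarrow> real" where
  "e0 L = (SUP q. energy L q 0)"

definition min_energy :: "lagrangian \<Rightarrow> real" where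
  "min_energy L = (INF (q, v). energy L q v)"

abbreviation velocity :: "(real \<Rightarrow> real^2) \<Rightarrow> real \<Rightarrow> real^2" where
  "velocity \<gamma> t \<equiv> vector_derivative \<gamma> (at t)"

definition euler_lagrange :: "lagrangian \<Rightarrow> (real \<Rightarrow> real^2) \<Rightarrow> bool" where
  "euler_lagrange L \<gamma> \<longleftrightarrow>
     (\<forall>t. \<gamma> differentiable (at t)) \<and>
     (\<forall>t. velocity \<gamma> differentiable (at t)) \<and>
     (\<forall>t w. ((\<lambda>s. L_v L (\<gamma> s) (velocity \<gamma> s) w)
               has_real_derivative L_q L (\<gamma> t) (velocity \<gamma> t) w) (at t))"

text \<open>
  A periodic orbit is a curve together with one of its (not necessarily minimal) periods.
  It need not be contractible: the lift is only periodic modulo the lattice.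
\<close>

definition periodic_orbit :: "lagrangian \<Rightarrow> real \<Rightarrow> (real \<Rightarrow> real^2) \<Rightarrow> real \<Rightarrow> bool" where
  "periodic_orbit L k \<gamma> \<tau> \<longleftrightarrow>
     \<tau> > 0 \<and> euler_lagrange L \<gamma> \<and>
     (\<forall>t. \<gamma> (t + \<tau>) - \<gamma> t \<in> lattice) \<and>
     (\<forall>t. energy L (\<gamma> t) (velocity \<gamma> t) = k)"

text \<open>
  On periodic orbits, this is the equivalence relation generated by the time-shifts
  \<open>(\<gamma>, \<tau>) \<sim> (\<gamma>(\<cdot> + s), \<tau>)\<close> and the iterations \<open>(\<gamma>, \<tau>) \<sim> (\<gamma>, n\<tau>)\<close>,
  for curves in the torus.
\<close>

definition same_orbit ::
    "(real \<Rightarrow> real^2) \<Rightarrow> real \<Rightarrow> (real \<Rightarrow> real^2) \<Rightarrow> real \<Rightarrow> bool" where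
  "same_orbit \<gamma> \<tau> \<gamma>' \<tau>' \<longleftrightarrow>
     (\<exists>m n::nat. m \<ge> 1 \<and> n \<ge> 1 \<and> real m * \<tau> = real n * \<tau>') \<and>
     (\<exists>s. \<forall>t. \<gamma>' t - \<gamma> (t + s) \<in> lattice)"

text \<open>
  Lifts of the loops of class $W^{1,2}$. An indefinite Lebesgue integral is differentiable
  almost everywhere with the integrand as derivative, so the last condition says that
  \<open>\<Gamma>\<close> is absolutely continuous and that \<^const>\<open>vector_derivative\<close> represents its weak
  derivative; its values on the null set where \<open>\<Gamma>\<close> is not differentiable are irrelevant.
\<close>

definition W12_loop :: "(real \<Rightarrow> real^2) \<Rightarrow> bool" where
  "W12_loop \<Gamma> \<longleftrightarrow>
     (\<exists>m\<in>lattice. \<forall>t. \<Gamma> (t + 1) = \<Gamma> t + m) \<and>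
     set_integrable lebesgue {0..1} (velocity \<Gamma>) \<and>
     set_integrable lebesgue {0..1} (\<lambda>t. (norm (velocity \<Gamma> t))\<^sup>2) \<and>
     (\<forall>t\<in>{0..1}. \<Gamma> t = \<Gamma> 0 + (LINT s:{0..t}|lebesgue. velocity \<Gamma> s))"

definition W12_dist :: "(real \<Rightarrow> real^2) \<Rightarrow> (real \<Rightarrow> real^2) \<Rightarrow> real" where
  "W12_dist \<Gamma> \<Delta> = sqrt
     ((LINT t:{0..1}|lebesgue. (norm (\<Gamma> t - \<Delta> t))\<^sup>2) +
      (LINT t:{0..1}|lebesgue. (norm (velocity \<Gamma> t - velocity \<Delta> t))\<^sup>2))"

text \<open>
  A Tonelli Lagrangian is bounded below, so for \<open>\<Gamma>\<close> of class $W^{1,2}$ the action integral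
  is \<open>\<infinity>\<close> when the integrand is not integrable.
\<close>

definition free_period_action ::
    "lagrangian \<Rightarrow> real \<Rightarrow> (real \<Rightarrow> real^2) \<Rightarrow> real \<Rightarrow> ereal" where
  "free_period_action L k \<Gamma> \<tau> =
     (if set_integrable lebesgue {0..1} (\<lambda>t. L (\<Gamma> t) (velocity \<Gamma> t /\<^sub>R \<tau>) + k)
      then ereal (\<tau> * (LINT t:{0..1}|lebesgue. L (\<Gamma> t) (velocity \<Gamma> t /\<^sub>R \<tau>) + k))
      else \<infinity>)"

text \<open>
  Two $W^{1,2}$ loops in the torus are close exactly when they have lifts that are close in
  the $W^{1,2}$ norm on the unit interval; such lifts differ by a 1-periodic map.
\<close>

definition local_minimizer :: "lagrangian \<Rightarrow> real \<Rightarrow> (real \<Rightarrow> real^2) \<Rightarrow> real \<Rightarrow> bool" where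
  "local_minimizer L k \<Gamma> \<tau> \<longleftrightarrow>
     W12_loop \<Gamma> \<and> \<tau> > 0 \<and>
     (\<exists>\<epsilon>>0. \<forall>\<Delta> \<sigma>. W12_loop \<Delta> \<and> \<sigma> > 0 \<and> W12_dist \<Gamma> \<Delta> < \<epsilon> \<and> \<bar>\<sigma> - \<tau>\<bar> < \<epsilon> \<longrightarrow>
        free_period_action L k \<Gamma> \<tau> \<le> free_period_action L k \<Delta> \<sigma>)"

end

theory Submission
  imports Defs "HOL-Computational_Algebra.Polynomial"
begin

text \<open>
  Take a mechanical Lagrangian $|v|^2/2 - V(q)$ whose potential has a single minimum on the
  torus, equal to $q_1^2/2 + q_2^2$ exactly in a neighbourhood of it. At low energy the motion
  is confined to that neighbourhood, where it consists of two uncoupled harmonic oscillations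
  with frequencies $1$ and $\sqrt 2$. Since their ratio is irrational, only the two normal
  modes are periodic. Translating a low-energy loop by \<open>s\<close> in the first coordinate changes
  the action by $-\tau (s \int x + s^2/2)$, where \<open>x\<close> is the first coordinate; for one
  of the two signs of \<open>s\<close> this is negative, so no such loop is a local minimizer.
\<close>


section \<open>Calculus of $C^k$ functions\<close>

text \<open>Derivatives are unique, so an explicitly known \<open>D\<close> can stand for the choice
  operator \<open>frechet_derivative\<close> in the recursion of \<open>C_k\<close>.\<close>

lemma C_k_SucI:
  assumes "\<And>x. (f has_derivative D x) (at x)" "\<And>u. C_k n (\<lambda>x. D x u)"
  shows "C_k (Suc n) f"
proof -
  have "frechet_derivative f (at x) = D x" for x
    using assms(1) frechet_derivative_at by metis
  with assms show ?thesis
    by (auto simp: differentiable_def)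
qed

lemma C_k_Suc_iff:
  "C_k (Suc n) f \<longleftrightarrow> (\<exists>D. (\<forall>x. (f has_derivative D x) (at x)) \<and> (\<forall>u. C_k n (\<lambda>x. D x u)))"
proof
  assume "C_k (Suc n) f"
  then show "\<exists>D. (\<forall>x. (f has_derivative D x) (at x)) \<and> (\<forall>u. C_k n (\<lambda>x. D x u))"
    by (intro exI[of _ "\<lambda>x. frechet_derivative f (at x)"]) (auto simp: frechet_derivative_works)
next
  assume "\<exists>D. (\<forall>x. (f has_derivative D x) (at x)) \<and> (\<forall>u. C_k n (\<lambda>x. D x u))"
  then show "C_k (Suc n) f"
    using C_k_SucI by blast
qed

lemma C_k_SucD: "C_k (Suc n) f \<Longrightarrow> C_k n f"
proof (induction n arbitrary: f)
  case 0
  then show ?case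
    by (auto simp: continuous_on_eq_continuous_at differentiable_imp_continuous_within)
next
  case (Suc n)
  obtain D where D: "\<And>x. (f has_derivative D x) (at x)" "\<And>u. C_k (Suc n) (\<lambda>x. D x u)"
    using Suc.prems unfolding C_k_Suc_iff[of _ f] by blast
  show ?case
    by (rule C_k_SucI[where D = D]) (use D Suc.IH in blast)+
qed

lemma C_k_const [simp]: "C_k n (\<lambda>x. c)"
proof (induction n arbitrary: c)
  case (Suc n)
  show ?case
    by (rule C_k_SucI[where D = "\<lambda>x u. 0"]) (use Suc in auto)
qed simp

lemma C_k_bounded_linear:
  assumes "bounded_linear f"
  shows "C_k n f"
proof (cases n)
  case 0
  with assms show ?thesis by (simp add: linear_continuous_on)
next
  case (Suc m)
  show ?thesis
    unfolding Suc
    by (rule C_k_SucI[where D = "\<lambda>x. f"]) (use assms bounded_linear_imp_has_derivative in auto)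
qed

lemma C_k_id: "C_k n (\<lambda>x. x)"
  by (rule C_k_bounded_linear) (rule bounded_linear_ident)

lemma C_k_add: "C_k n f \<Longrightarrow> C_k n g \<Longrightarrow> C_k n (\<lambda>x. f x + g x)"
proof (induction n arbitrary: f g)
  case 0
  then show ?case by (auto intro: continuous_on_add)
next
  case (Suc n)
  obtain D where D: "\<And>x. (f has_derivative D x) (at x)" "\<And>u. C_k n (\<lambda>x. D x u)"
    using Suc.prems(1) unfolding C_k_Suc_iff by blast
  obtain E where E: "\<And>x. (g has_derivative E x) (at x)" "\<And>u. C_k n (\<lambda>x. E x u)"
    using Suc.prems(2) unfolding C_k_Suc_iff by blast
  show ?case
    by (rule C_k_SucI[where D = "\<lambda>x u. D x u + E x u"])
      (use D E Suc.IH in \<open>auto intro: has_derivative_add\<close>)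
qed

lemma C_k_mult:
  fixes f g :: "'a::real_normed_vector \<Rightarrow> real"
  shows "C_k n f \<Longrightarrow> C_k n g \<Longrightarrow> C_k n (\<lambda>x. f x * g x)"
proof (induction n arbitrary: f g)
  case 0
  then show ?case by (auto intro: continuous_on_mult)
next
  case (Suc n)
  from Suc.prems have n: "C_k n f" "C_k n g"
    by (auto dest: C_k_SucD simp del: C_k.simps)
  obtain D where D: "\<And>x. (f has_derivative D x) (at x)" "\<And>u. C_k n (\<lambda>x. D x u)"
    using Suc.prems(1) unfolding C_k_Suc_iff by blast
  obtain E where E: "\<And>x. (g has_derivative E x) (at x)" "\<And>u. C_k n (\<lambda>x. E x u)"
    using Suc.prems(2) unfolding C_k_Suc_iff by blast
  show ?case
    by (rule C_k_SucI[where D = "\<lambda>x u. f x * E x u + D x u * g x"])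
      (use D E n Suc.IH in \<open>auto intro!: has_derivative_mult C_k_add\<close>)
qed

lemma C_k_diff:
  fixes f g :: "'a::real_normed_vector \<Rightarrow> real"
  assumes "C_k n f" "C_k n g"
  shows "C_k n (\<lambda>x. f x - g x)"
  using C_k_add[OF assms(1) C_k_mult[OF C_k_const[of n "-1"] assms(2)]] by simp

lemma C_k_sum:
  assumes "\<And>i. i \<in> I \<Longrightarrow> C_k n (f i)"
  shows "C_k n (\<lambda>x. \<Sum>i\<in>I. f i x)"
  using assms
proof (induction I rule: infinite_finite_induct)
  case (insert i I)
  then show ?case by (simp add: C_k_add del: C_k.simps)
qed simp_all

text \<open>With a real outer function the chain rule becomes a product: the factor coming from
  \<open>f\<close> is C^n by the induction hypothesis, and \<open>C_k_mult\<close> does the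
  rest.\<close>

lemma C_k_compose:
  fixes f :: "real \<Rightarrow> real" and g :: "'a::real_normed_vector \<Rightarrow> real"
  shows "C_k n f \<Longrightarrow> C_k n g \<Longrightarrow> C_k n (\<lambda>x. f (g x))"
proof (induction n arbitrary: f g)
  case 0
  then show ?case
    using continuous_on_compose2[of UNIV f UNIV g] by auto
next
  case (Suc n)
  from Suc.prems have n: "C_k n g"
    by (auto dest: C_k_SucD simp del: C_k.simps)
  obtain D where D: "\<And>x. (f has_derivative D x) (at x)" "\<And>u. C_k n (\<lambda>x. D x u)"
    using Suc.prems(1) unfolding C_k_Suc_iff by blast
  obtain E where E: "\<And>x. (g has_derivative E x) (at x)" "\<And>u. C_k n (\<lambda>x. E x u)"
    using Suc.prems(2) unfolding C_k_Suc_iff by blast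
  \<comment> \<open>A linear map on the reals is multiplication by its value at 1, so the derivative
    of \<open>f\<close> reduces to the scalar function \<open>\<lambda>y. D y 1\<close>.\<close>
  have lin: "D y u = D y 1 * u" for y u
    using linear_scale[OF has_derivative_linear[OF D(1)[of y]], of u 1] by simp
  show ?case
  proof (rule C_k_SucI[where D = "\<lambda>x u. D (g x) 1 * E x u"])
    fix x
    have "((\<lambda>x. f (g x)) has_derivative (\<lambda>u. D (g x) (E x u))) (at x)"
      using has_derivative_compose[OF E(1) D(1)] .
    then show "((\<lambda>x. f (g x)) has_derivative (\<lambda>u. D (g x) 1 * E x u)) (at x)"
      by (subst (asm) lin)
  qed (use Suc.IH[OF D(2) n] E(2) in \<open>auto intro: C_k_mult\<close>)
qed

text \<open>The derivative of 1/f is -(1/f) f' (1/f), whose factors are C^n by hypothesis and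
  induction.\<close>

lemma C_k_inverse:
  fixes f :: "'a::real_normed_vector \<Rightarrow> real"
  assumes "\<And>x. f x \<noteq> 0"
  shows "C_k n f \<Longrightarrow> C_k n (\<lambda>x. inverse (f x))"
proof (induction n)
  case 0
  then show ?case using assms by (auto intro: continuous_on_inverse)
next
  case (Suc n)
  then have IH: "C_k n (\<lambda>x. inverse (f x))"
    by (auto dest: C_k_SucD simp del: C_k.simps)
  from Suc.prems obtain D where D: "\<And>x. (f has_derivative D x) (at x)" "\<And>u. C_k n (\<lambda>x. D x u)"
    unfolding C_k_Suc_iff by blast
  show ?case
  proof (rule C_k_SucI[where D = "\<lambda>x u. - 1 * (inverse (f x) * D x u * inverse (f x))"])
    show "((\<lambda>x. inverse (f x)) has_derivative
        (\<lambda>u. - 1 * (inverse (f x) * D x u * inverse (f x)))) (at x)" for x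
      using Deriv.has_derivative_inverse[OF assms D(1), of x] by simp
  qed (intro C_k_mult C_k_const IH D(2))
qed

text \<open>Smoothness is local. This allows \<open>well\<close> to be glued from pieces, with
  \<open>U\<close> and \<open>g\<close> chosen separately at each point.\<close>

lemma C_k_local:
  assumes "\<And>x. \<exists>U g. open U \<and> x \<in> U \<and> C_k n g \<and> (\<forall>y\<in>U. f y = g y)"
  shows "C_k n f"
  using assms
proof (induction n arbitrary: f)
  case 0
  have "isCont f x" for x
  proof -
    from 0 obtain U g where U: "open U" "x \<in> U" "C_k 0 g" "\<forall>y\<in>U. f y = g y"
      by blast
    then have "\<forall>\<^sub>F y in nhds x. f y = g y"
      by (auto simp: eventually_nhds)
    from isCont_cong[OF this] U show ?thesis
      by (auto simp: continuous_on_eq_continuous_at)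
  qed
  then show ?case by (simp add: continuous_on_eq_continuous_at)
next
  case (Suc n)
  have loc: "\<exists>U D. open U \<and> x \<in> U \<and> (\<forall>y\<in>U. (f has_derivative D y) (at y)) \<and>
    (\<forall>u. C_k n (\<lambda>y. D y u))" for x
  proof -
    from Suc.prems[of x] obtain U g where U: "open U" "x \<in> U" "\<forall>y\<in>U. f y = g y" "C_k (Suc n) g"
      by blast
    from U(4) obtain D where D: "\<And>x. (g has_derivative D x) (at x)" "\<And>u. C_k n (\<lambda>x. D x u)"
      unfolding C_k_Suc_iff by blast
    have "(f has_derivative D y) (at y)" if "y \<in> U" for y
      by (rule has_derivative_transform_within_open[OF D(1) U(1) that]) (use U in auto)
    with U(1,2) D(2) show ?thesis
      by (intro exI[of _ U] exI[of _ D] conjI ballI allI)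
  qed
  show ?case
  proof (rule C_k_SucI)
    show "(f has_derivative frechet_derivative f (at x)) (at x)" for x
      using loc[of x] by (auto simp: frechet_derivative_works[symmetric] differentiable_def)
    fix u
    show "C_k n (\<lambda>x. frechet_derivative f (at x) u)"
    proof (rule Suc.IH)
      fix x
      from loc[of x] obtain U D where U: "open U" "x \<in> U"
        "\<forall>y\<in>U. (f has_derivative D y) (at y)" "\<forall>u. C_k n (\<lambda>y. D y u)"
        by blast
      \<comment> \<open>Since \<open>D\<close> is the derivative on the whole open set
        \<open>U\<close>, not only at \<open>x\<close>, the local representation passes to the
        derivative.\<close>
      have "\<forall>y\<in>U. frechet_derivative f (at y) u = D y u"
        using U(3) by (auto simp flip: frechet_derivative_at)
      with U(1,2,4) show "\<exists>U g. open U \<and> x \<in> U \<and> C_k n g \<and>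
          (\<forall>y\<in>U. frechet_derivative f (at y) u = g y)"
        by (intro exI[of _ U] exI[of _ "\<lambda>y. D y u"] conjI) auto
    qed
  qed
qed

section \<open>A periodic well that is exactly quadratic near the integers\<close>

text \<open>The polynomial factor makes this family closed under differentiation.\<close>

definition flat :: "real poly \<Rightarrow> real \<Rightarrow> real" where
  "flat p x = (if x > 0 then poly p (1 / x) * exp (- (1 / x)) else 0)"

lemma tendsto_poly_exp_minus:
  "((\<lambda>y. poly p y * exp (- y)) \<longlongrightarrow> (0::real)) at_top"
proof -
  have "((\<lambda>y. \<Sum>i\<le>degree p. coeff p i * (y ^ i / exp y)) \<longlongrightarrow> (\<Sum>i\<le>degree p. coeff p i * 0)) at_top"
    by (intro tendsto_sum tendsto_mult tendsto_const tendsto_power_div_exp_0)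
  then show ?thesis
    by (simp add: poly_altdef sum_distrib_right exp_minus divide_inverse mult.assoc)
qed

text \<open>With y = 1/x and dy/dx = -y^2, the derivative of p(y) e^(-y) is y^2 (p(y) - p'(y))
  e^(-y). At 0 the right difference quotient y p(y) e^(-y) tends to 0, since exponential decay beats
  every polynomial.\<close>

lemma flat_deriv:
  "(flat p has_real_derivative flat ([:0, 0, 1:] * (p - pderiv p)) x) (at x)"
proof -
  consider "x > 0" | "x < 0" | "x = 0" by linarith
  then show ?thesis
  proof cases
    case 1
    have "((\<lambda>x. poly p (1 / x) * exp (- (1 / x))) has_real_derivative
        flat ([:0, 0, 1:] * (p - pderiv p)) x) (at x)"
      using 1
      by (auto intro!: derivative_eq_intros DERIV_chain2[where f = "poly p", OF poly_DERIV]
          simp: flat_def field_simps power2_eq_square)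
    then show ?thesis
      by (rule has_field_derivative_transform_within_open[where S = "{0<..}"])
        (use 1 in \<open>auto simp: flat_def\<close>)
  next
    case 2
    have "((\<lambda>x. 0) has_real_derivative flat ([:0, 0, 1:] * (p - pderiv p)) x) (at x)"
      using 2 by (simp add: flat_def)
    then show ?thesis
      by (rule has_field_derivative_transform_within_open[where S = "{..<0}"])
        (use 2 in \<open>auto simp: flat_def\<close>)
  next
    case 3
    \<comment> \<open>\<open>pCons 0 p\<close> is the polynomial y p(y): dividing
      \<open>flat p h\<close> by \<open>h\<close> multiplies by y = 1/h.\<close>
    have "((\<lambda>h. poly (pCons 0 p) (inverse h) * exp (- inverse h)) \<longlongrightarrow> 0) (at_right (0::real))"
      by (rule filterlim_compose[OF tendsto_poly_exp_minus filterlim_inverse_at_top_right])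
    moreover have "\<forall>\<^sub>F h in at_right (0::real).
        poly (pCons 0 p) (inverse h) * exp (- inverse h) = flat p h / h"
      by (auto simp: eventually_at_filter flat_def field_simps)
    ultimately have "((\<lambda>h. flat p h / h) \<longlongrightarrow> 0) (at_right 0)"
      by (rule Lim_transform_eventually)
    moreover have "((\<lambda>h. flat p h / h) \<longlongrightarrow> 0) (at_left 0)"
      by (rule tendsto_eventually) (auto simp: eventually_at_filter flat_def)
    ultimately have "((\<lambda>h. flat p h / h) \<longlongrightarrow> 0) (at 0)"
      by (simp add: filterlim_split_at)
    with 3 show ?thesis
      by (simp add: has_field_derivative_iff flat_def)
  qed
qed

lemma C_k_flat: "C_k n (flat p)"
proof (induction n arbitrary: p)
  case 0
  then show ?case
    using flat_deriv by (auto simp: continuous_on_eq_continuous_at intro: DERIV_isCont)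
next
  case (Suc n)
  show ?case
    by (rule C_k_SucI[where D = "\<lambda>x u. flat ([:0, 0, 1:] * (p - pderiv p)) x * u"])
      (use flat_deriv Suc in \<open>auto simp: has_field_derivative_def intro!: C_k_mult\<close>)
qed

text \<open>The usual smooth transition, from 1 for y^2 \<le> 1/16 to 0 for y^2 \<ge> 1/8. The first
  bound gives the radius 1/4 of the exactly quadratic zone; the second leaves a collar of zeros
  around |y| = 1/2.\<close>

definition cutoff :: "real \<Rightarrow> real" where
  "cutoff y = flat 1 (1/8 - y\<^sup>2) * inverse (flat 1 (1/8 - y\<^sup>2) + flat 1 (y\<^sup>2 - 1/16))"

text \<open>As 1/16 < 1/8, at least one of the two arguments is positive.\<close>

lemma cutoff_denominator_pos: "flat 1 (1/8 - y\<^sup>2) + flat 1 (y\<^sup>2 - 1/16) > 0"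
  by (auto simp: flat_def add_pos_pos)

lemma C_k_cutoff: "C_k n cutoff"
proof -
  have "C_k n (\<lambda>y::real. y\<^sup>2)"
    unfolding power2_eq_square by (intro C_k_mult C_k_id)
  then have "C_k n (\<lambda>y. flat 1 (1/8 - y\<^sup>2))" "C_k n (\<lambda>y. flat 1 (y\<^sup>2 - 1/16))"
    by (auto intro!: C_k_compose[OF C_k_flat] C_k_diff)
  then show ?thesis
    unfolding cutoff_def[abs_def] using cutoff_denominator_pos
    by (intro C_k_mult C_k_inverse C_k_add) (auto simp: less_imp_neq[symmetric])
qed

lemma cutoff_bounds: "0 \<le> cutoff y" "cutoff y \<le> 1"
proof -
  have "flat 1 x \<ge> 0" for x by (simp add: flat_def)
  then show "0 \<le> cutoff y" "cutoff y \<le> 1"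
    using cutoff_denominator_pos[of y] by (auto simp: cutoff_def divide_inverse[symmetric])
qed

section \<open>The well profile and its periodic extension\<close>

definition bump_well :: "real \<Rightarrow> real" where
  "bump_well y = 1 + cutoff y * (y\<^sup>2 / 2 - 1)"

text \<open>\<open>round\<close> jumps only at half-integers, and there the profile is locally
  constant, so the jumps are invisible.\<close>

definition well :: "real \<Rightarrow> real" where
  "well x = bump_well (x - of_int (round x))"

lemma bump_well_inner: "y\<^sup>2 \<le> 1/16 \<Longrightarrow> bump_well y = y\<^sup>2 / 2"
  using cutoff_denominator_pos[of y] by (auto simp: bump_well_def cutoff_def flat_def)

lemma bump_well_outer: "y\<^sup>2 \<ge> 1/8 \<Longrightarrow> bump_well y = 1"
  by (auto simp: bump_well_def cutoff_def flat_def)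

lemma C_k_bump_well: "C_k n bump_well"
proof -
  have "C_k n (\<lambda>y::real. 1/2 * (y * y))"
    by (intro C_k_mult C_k_id C_k_const)
  then have "C_k n (\<lambda>y::real. y\<^sup>2 / 2)"
    by (simp add: power2_eq_square)
  from C_k_add[OF C_k_const C_k_mult[OF C_k_cutoff C_k_diff[OF this C_k_const]]]
  show ?thesis
    unfolding bump_well_def[abs_def] .
qed

lemma abs_frac_round_le: "\<bar>x - of_int (round x)\<bar> \<le> (1/2 :: real)"
  using of_int_round_abs_le[of x] by (simp add: abs_minus_commute)

lemma round_eqI: "\<bar>x - of_int n\<bar> < (1/2 :: real) \<Longrightarrow> round x = n"
  by (rule round_unique') simp

lemma C_k_well: "C_k n well"
proof (rule C_k_local)
  fix x :: real
  let ?n = "round x"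
  show "\<exists>U g. open U \<and> x \<in> U \<and> C_k n g \<and> (\<forall>y\<in>U. well y = g y)"
  proof (cases "\<bar>x - of_int ?n\<bar> < 1/2")
    case True
    \<comment> \<open>Away from half-integers rounding is locally constant, so \<open>well\<close>
      is locally a translate of \<open>bump_well\<close>.\<close>
    let ?U = "{y::real. \<bar>y - of_int ?n\<bar> < 1/2}"
    have "open ?U" by (intro open_Collect_less continuous_intros)
    moreover have "C_k n (\<lambda>y. bump_well (y - of_int ?n))"
      by (intro C_k_compose[OF C_k_bump_well] C_k_diff C_k_id C_k_const)
    moreover have "\<forall>y\<in>?U. well y = bump_well (y - of_int ?n)"
      unfolding well_def using round_eqI by fastforce
    ultimately show ?thesis using True by blast
  next
    case False
    \<comment> \<open>Here \<open>x\<close> is a half-integer. A point within 1/8 of it is at least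
      3/8 from its nearest integer, and (3/8)^2 = 9/64 exceeds 1/8.\<close>
    have "well y = 1" if y: "\<bar>y - x\<bar> < 1/8" for y
    proof -
      have "\<bar>y - of_int (round y)\<bar> \<ge> 3/8"
      proof (rule ccontr)
        assume "\<not> ?thesis"
        with y have "\<bar>x - of_int (round y)\<bar> < 1/2" by linarith
        with False show False using round_eqI by metis
      qed
      then have "(3/8)\<^sup>2 \<le> \<bar>y - of_int (round y)\<bar>\<^sup>2"
        by (intro power_mono) auto
      then show ?thesis
        unfolding well_def by (intro bump_well_outer) (auto simp: power2_eq_square)
    qed
    moreover have "open {y. \<bar>y - x\<bar> < 1/8}" by (intro open_Collect_less continuous_intros)
    ultimately show ?thesis
      by (intro exI[of _ "{y. \<bar>y - x\<bar> < 1/8}"] exI[of _ "\<lambda>_. 1"]) auto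
  qed
qed

lemma well_add_Ints:
  assumes "m \<in> \<int>"
  shows "well (x + m) = well x"
proof -
  from assms obtain n where "m = of_int n" by (elim Ints_cases)
  moreover have "round (x + of_int n) = round x + n"
    using floor_add_int[of "x + 1/2" n] by (simp add: round_def algebra_simps)
  ultimately show ?thesis by (simp add: well_def)
qed

text \<open>\<open>bump_well y\<close> is a convex combination of y^2/2 and 1 with weight
  \<open>cutoff y\<close>, and y^2/2 < 1 for an offset from the nearest integer. The lower bound
  later turns small energy into confinement.\<close>

lemma well_ge: "well x \<ge> (x - of_int (round x))\<^sup>2 / 2" and well_le: "well x \<le> 1"
proof -
  let ?y = "x - of_int (round x)"
  have "\<bar>?y\<bar>\<^sup>2 \<le> (1/2)\<^sup>2"
    using abs_frac_round_le[of x] by (intro power_mono) auto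
  then have y: "?y\<^sup>2 / 2 - 1 \<le> 0" by (simp add: power2_eq_square)
  show "well x \<ge> ?y\<^sup>2 / 2"
    using mult_right_mono_neg[OF cutoff_bounds(2) y, of ?y] by (simp add: well_def bump_well_def)
  show "well x \<le> 1"
    using mult_nonneg_nonpos[OF cutoff_bounds(1) y, of ?y] by (simp add: well_def bump_well_def)
qed

lemma well_nonneg: "well x \<ge> 0"
  using well_ge[of x] by (meson order_trans zero_le_divide_iff zero_le_numeral zero_le_power2)

lemma well_near_int:
  assumes "\<bar>x - of_int n\<bar> < 1/4"
  shows "well x = (x - of_int n)\<^sup>2 / 2"
proof -
  have "round x = n" using assms by (intro round_eqI) auto
  moreover have "\<bar>x - of_int n\<bar>\<^sup>2 \<le> (1/4)\<^sup>2"
    using assms by (intro power_mono) auto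
  ultimately show ?thesis
    unfolding well_def by (simp add: bump_well_inner power2_eq_square)
qed

lemma well_half: "well (1/2) = 1"
  unfolding well_def by (rule bump_well_outer) (simp add: round_def power2_eq_square)

lemma well_deriv:
  assumes "\<bar>x - of_int n\<bar> < 1/4"
  shows "(well has_real_derivative x - of_int n) (at x)"
proof -
  have "((\<lambda>x. (x - of_int n)\<^sup>2 / 2) has_real_derivative x - of_int n) (at x)"
    by (auto intro!: derivative_eq_intros)
  moreover have "open {y. \<bar>y - real_of_int n\<bar> < 1/4}"
    by (intro open_Collect_less continuous_intros)
  ultimately show ?thesis
    by (rule has_field_derivative_transform_within_open) (use assms in \<open>auto simp: well_near_int\<close>)
qed

section \<open>Two uncoupled oscillators with incommensurable frequencies\<close>

text \<open>Squared frequencies, chosen so that their ratio 2 has no rational square root.\<close>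

definition stiffness :: "2 \<Rightarrow> real" where
  "stiffness i = (if i = 1 then 1 else 2)"

abbreviation freq :: "2 \<Rightarrow> real" where
  "freq i \<equiv> sqrt (stiffness i)"

definition potential :: "real^2 \<Rightarrow> real" where
  "potential q = (\<Sum>i\<in>UNIV. stiffness i * well (q $ i))"

definition oscillator :: lagrangian where
  "oscillator q v = (v \<bullet> v) / 2 - potential q"

lemma stiffness_ge_1: "stiffness i \<ge> 1"
  by (simp add: stiffness_def)

lemma stiffness_pos: "stiffness i > 0" and freq_pos: "freq i > 0" and freq_ge_1: "freq i \<ge> 1"
  using stiffness_ge_1[of i] by auto

lemma freq_squared: "(freq i)\<^sup>2 = stiffness i"
  using stiffness_pos[of i] by simp

lemma potential_nonneg: "potential q \<ge> 0"
  unfolding potential_def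
  by (intro sum_nonneg mult_nonneg_nonneg less_imp_le[OF stiffness_pos] well_nonneg)

lemma potential_le_3: "potential q \<le> 3"
  using well_le[of "q $ 1"] well_le[of "q $ 2"] by (simp add: potential_def UNIV_2 stiffness_def)

lemma well_le_potential: "well (q $ i) \<le> potential q"
proof -
  have "well (q $ i) \<le> stiffness i * well (q $ i)"
    using mult_right_mono[OF stiffness_ge_1 well_nonneg] by simp
  also have "\<dots> \<le> potential q"
    unfolding potential_def
    by (rule member_le_sum) (auto intro: mult_nonneg_nonneg less_imp_le[OF stiffness_pos] well_nonneg)
  finally show ?thesis .
qed

section \<open>Derivatives, energy and the Tonelli property of the oscillator\<close>

lemma L_v_oscillator: "L_v oscillator q v w = v \<bullet> w"
proof -
  have "(oscillator q has_derivative (\<lambda>w. v \<bullet> w)) (at v)"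
    unfolding oscillator_def[abs_def]
    by (auto intro!: derivative_eq_intros simp: inner_commute)
  from frechet_derivative_at[OF this] show ?thesis
    by (simp add: L_v_def)
qed

lemma L_vv_oscillator: "L_vv oscillator q v u w = w \<bullet> u"
proof -
  have "((\<lambda>y. y \<bullet> u) has_derivative (\<lambda>w. w \<bullet> u)) (at v)"
    by (auto intro!: derivative_eq_intros)
  from frechet_derivative_at[OF this] show ?thesis
    by (simp add: L_vv_def L_v_oscillator)
qed

lemma energy_oscillator: "energy oscillator q v = (v \<bullet> v) / 2 + potential q"
  by (simp add: energy_def L_v_oscillator oscillator_def)

lemma tonelli_oscillator: "tonelli oscillator"
  unfolding tonelli_def
proof (intro conjI allI ballI impI)
  show "smooth (\<lambda>(q, v). oscillator q v)"
    unfolding smooth_def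
  proof
    fix n
    have snd: "C_k n (\<lambda>x::(real^2) \<times> (real^2). snd x $ i)" for i
      by (rule C_k_bounded_linear)
        (rule bounded_linear_compose[OF bounded_linear_vec_nth bounded_linear_snd])
    have fst: "C_k n (\<lambda>x::(real^2) \<times> (real^2). fst x $ i)" for i
      by (rule C_k_bounded_linear)
        (rule bounded_linear_compose[OF bounded_linear_vec_nth bounded_linear_fst])
    have "C_k n (\<lambda>x::(real^2) \<times> (real^2).
        1/2 * (\<Sum>i\<in>UNIV. snd x $ i * snd x $ i) - (\<Sum>i\<in>UNIV. stiffness i * well (fst x $ i)))"
      by (intro C_k_diff C_k_sum C_k_mult C_k_const snd C_k_compose[OF C_k_well fst])
    then show "C_k n (\<lambda>(q, v). oscillator q v)"
      by (simp add: case_prod_unfold oscillator_def potential_def inner_vec_def)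
  qed
  show "oscillator (q + m) v = oscillator q v" if "m \<in> lattice" for q m v
    using that by (simp add: oscillator_def potential_def lattice_def well_add_Ints)
  show "filterlim (\<lambda>v. oscillator q v / norm v) at_top at_infinity" for q
    unfolding filterlim_at_top eventually_at_infinity
  proof (intro allI exI impI)
    fix Z and v :: "real^2"
    \<comment> \<open>3 bounds the potential. The bound 2 (Z + 3) gives Z \<le> |v|/2 - 3, and |v|
      \<ge> 1 gives 3 \<le> 3 |v|.\<close>
    assume v: "max 1 (2 * (Z + 3)) \<le> norm v"
    have "Z * norm v \<le> (norm v / 2 - 3) * norm v"
      using v by (intro mult_right_mono) auto
    also have "\<dots> \<le> (norm v)\<^sup>2 / 2 - 3"
      using v by (simp add: power2_eq_square algebra_simps)
    also have "\<dots> \<le> oscillator q v"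
      using potential_le_3[of q] by (simp add: oscillator_def power2_norm_eq_inner)
    finally show "Z \<le> oscillator q v / norm v"
      using v by (subst pos_le_divide_eq) linarith+
  qed
  show "0 < L_vv oscillator q v u u" if "u \<noteq> 0" for q v u
    using that by (simp add: L_vv_oscillator)
qed

lemma min_energy_oscillator: "min_energy oscillator = 0"
  unfolding min_energy_def
proof (rule cInf_eq_minimum)
  have "well 0 = 0"
    using well_near_int[of 0 0] by simp
  then show "0 \<in> range (\<lambda>(q, v). energy oscillator q v)"
    by (auto simp: energy_oscillator potential_def intro!: image_eqI[of _ _ "(0, 0)"])
qed (auto simp: energy_oscillator intro!: add_nonneg_nonneg potential_nonneg)

text \<open>At the centre of the cell both wells have height 1, so rest there has energy 1 + 2 = 3.
  A real supremum dominates its terms only for bounded families, hence the appeal to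
  \<open>potential_le_3\<close>.\<close>

lemma e0_oscillator: "e0 oscillator > 0"
proof -
  have "3 = energy oscillator (\<chi> i. 1/2) 0"
    by (simp add: energy_oscillator potential_def well_half UNIV_2 stiffness_def)
  also have "\<dots> \<le> e0 oscillator"
    unfolding e0_def
    by (rule cSUP_upper) (auto simp: energy_oscillator intro!: bdd_aboveI[of _ 3] potential_le_3)
  finally show ?thesis by simp
qed

section \<open>The quadratic zone around an equilibrium\<close>

lemma potential_near_equilibrium:
  assumes "\<And>i. \<bar>q $ i - of_int (m i)\<bar> < 1/4"
  shows "potential q = (\<Sum>i\<in>UNIV. stiffness i * (q $ i - of_int (m i))\<^sup>2 / 2)"
  by (simp add: potential_def well_near_int[OF assms])

text \<open>A lift may oscillate around any translate of the equilibrium, so the linear restoring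
  force is computed around an arbitrary lattice point \<open>m\<close>.\<close>

lemma L_q_near_equilibrium:
  assumes "\<And>i. \<bar>q $ i - of_int (m i)\<bar> < 1/4"
  shows "L_q oscillator q v w = - (\<Sum>i\<in>UNIV. stiffness i * (q $ i - of_int (m i)) * w $ i)"
proof -
  have "((\<lambda>x. well (x $ i)) has_derivative (\<lambda>w. (q $ i - of_int (m i)) * w $ i)) (at q)" for i
    using has_derivative_compose[OF bounded_linear_imp_has_derivative[OF bounded_linear_vec_nth]
        well_deriv[OF assms, unfolded has_field_derivative_def]] .
  then have "((\<lambda>x. oscillator x v) has_derivative
      (\<lambda>w. 0 - (\<Sum>i\<in>UNIV. stiffness i * ((q $ i - of_int (m i)) * w $ i)))) (at q)"
    unfolding oscillator_def potential_def
    by (intro has_derivative_diff has_derivative_const has_derivative_sum has_derivative_mult_right)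
  from frechet_derivative_at[OF this, symmetric] show ?thesis
    by (simp add: L_q_def mult.assoc)
qed

section \<open>Low-energy orbits\<close>

text \<open>At each time the nearest integer is closer than 1/4. To change that integer, a
  continuous path would have to be at distance exactly 1/4 from \<open>n\<close> at some time; but
  then \<open>n\<close> would still be the nearest integer, contradicting the strict bound.\<close>

lemma well_confines:
  assumes "continuous_on UNIV x" "\<And>t::real. well (x t) < 1/32"
  obtains n :: int where "\<And>t. \<bar>x t - of_int n\<bar> < 1/4"
proof -
  have near: "\<bar>x t - of_int (round (x t))\<bar> < 1/4" for t
  proof -
    \<comment> \<open>The threshold 1/32 is (1/4)^2/2, the height of the parabola at the edge of the
      quadratic zone.\<close>
    have "\<bar>x t - of_int (round (x t))\<bar>\<^sup>2 < (1/4)\<^sup>2"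
      using well_ge[of "x t"] assms(2)[of t] by (simp add: power2_eq_square)
    then show ?thesis by (rule power2_less_imp_less) simp
  qed
  define n where "n = round (x 0)"
  let ?h = "\<lambda>t. \<bar>x t - of_int n\<bar>"
  have "?h t < 1/4" for t
  proof (rule ccontr)
    assume "\<not> ?thesis"
    moreover have "connected (range ?h)"
      by (intro connected_continuous_image continuous_intros assms(1) connected_UNIV)
    moreover have "?h 0 < 1/4"
      using near by (simp add: n_def)
    ultimately have "1/4 \<in> range ?h"
      using connected_contains_Icc[of "range ?h" "?h 0" "?h t"] by auto
    then obtain u where u: "?h u = 1/4" by force
    then have "round (x u) = n" by (intro round_eqI) simp
    with near[of u] u show False by simp
  qed
  with that show thesis by blast
qed

lemma orbit_continuous:
  assumes "periodic_orbit L k \<gamma> \<tau>"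
  shows "continuous_on S \<gamma>"
  using assms
  by (auto simp: periodic_orbit_def euler_lagrange_def
      intro!: continuous_at_imp_continuous_on differentiable_imp_continuous_within)

text \<open>Kinetic energy is nonnegative, so the well of each coordinate stays at most
  \<open>k\<close> along the orbit and \<open>well_confines\<close> applies coordinatewise.\<close>

lemma orbit_near_equilibrium:
  assumes "periodic_orbit oscillator k \<gamma> \<tau>" "k < 1/32"
  obtains m :: "2 \<Rightarrow> int" where "\<And>t i. \<bar>\<gamma> t $ i - of_int (m i)\<bar> < 1/4"
proof -
  have "well (\<gamma> t $ i) < 1/32" for t i
  proof -
    have "well (\<gamma> t $ i) \<le> energy oscillator (\<gamma> t) (velocity \<gamma> t)"
      using well_le_potential[of "\<gamma> t" i] by (auto simp: energy_oscillator intro: add_increasing)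
    with assms show ?thesis by (simp add: periodic_orbit_def)
  qed
  moreover have "continuous_on UNIV (\<lambda>t. \<gamma> t $ i)" for i
    by (intro continuous_intros orbit_continuous[OF assms(1)])
  ultimately have "\<exists>n::int. \<forall>t. \<bar>\<gamma> t $ i - of_int n\<bar> < 1/4" for i
    using well_confines by metis
  with that show thesis by metis
qed

section \<open>Solutions of the harmonic oscillator\<close>

lemma harmonic_motion:
  fixes x v :: "real \<Rightarrow> real"
  assumes "\<omega> > 0"
    and x: "\<And>t. (x has_real_derivative v t) (at t)"
    and v: "\<And>t. (v has_real_derivative - (\<omega>\<^sup>2 * x t)) (at t)"
  obtains A s where "A \<ge> 0" "\<And>t. x t = A * cos (\<omega> * (t + s))"
    "\<And>t. v t = - (A * \<omega> * sin (\<omega> * (t + s)))"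
proof -
  \<comment> \<open>\<open>C\<close> and \<open>S\<close> are the phase point
    (\<open>\<omega> * x\<close>, \<open>v\<close>) rotated back by the angle of the flow, so they
    are constants of motion; their polar form gives amplitude and phase.\<close>
  define C where "C t = \<omega> * x t * cos (\<omega> * t) - v t * sin (\<omega> * t)" for t
  define S where "S t = \<omega> * x t * sin (\<omega> * t) + v t * cos (\<omega> * t)" for t
  have "(C has_real_derivative 0) (at t)" for t
    unfolding C_def[abs_def]
    by (auto intro!: derivative_eq_intros x v simp: algebra_simps power2_eq_square)
  then have C: "C t = C 0" for t
    using DERIV_isconst_all by blast
  have "(S has_real_derivative 0) (at t)" for t
    unfolding S_def[abs_def]
    by (auto intro!: derivative_eq_intros x v simp: algebra_simps power2_eq_square)
  then have S: "S t = S 0" for t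
    using DERIV_isconst_all by blast
  obtain r0 a0 where "C 0 = r0 * cos a0" "S 0 = r0 * sin a0"
    using polar_Ex by blast
  \<comment> \<open>A negative radius is made nonnegative by shifting the angle by pi. With this
    sign convention the energy can later determine the amplitude.\<close>
  then have "C 0 = \<bar>r0\<bar> * cos (if r0 \<ge> 0 then a0 else a0 + pi)"
    "S 0 = \<bar>r0\<bar> * sin (if r0 \<ge> 0 then a0 else a0 + pi)"
    by auto
  then obtain r a where ra: "r \<ge> 0" "C 0 = r * cos a" "S 0 = r * sin a"
    by (metis abs_ge_zero)
  show thesis
  proof (rule that[of "r / \<omega>" "- (a / \<omega>)"])
    show "r / \<omega> \<ge> 0" using ra(1) assms(1) by simp
    fix t
    have arg: "\<omega> * (t + - (a / \<omega>)) = \<omega> * t - a"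
      using assms(1) by (simp add: field_simps)
    have "\<omega> * x t = \<omega> * x t * ((sin (\<omega> * t))\<^sup>2 + (cos (\<omega> * t))\<^sup>2)"
      by simp
    also have "\<dots> = C t * cos (\<omega> * t) + S t * sin (\<omega> * t)"
      unfolding C_def S_def by algebra
    also have "\<dots> = r * cos (\<omega> * t - a)"
      by (simp add: C[of t] S[of t] ra cos_diff algebra_simps)
    finally show "x t = r / \<omega> * cos (\<omega> * (t + - (a / \<omega>)))"
      using assms(1) unfolding arg by (simp add: field_simps)
    have "v t = v t * ((sin (\<omega> * t))\<^sup>2 + (cos (\<omega> * t))\<^sup>2)"
      by simp
    also have "\<dots> = S t * cos (\<omega> * t) - C t * sin (\<omega> * t)"
      unfolding C_def S_def by algebra
    also have "\<dots> = - (r * sin (\<omega> * t - a))"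
      by (simp add: C[of t] S[of t] ra sin_diff algebra_simps)
    finally show "v t = - (r / \<omega> * \<omega> * sin (\<omega> * (t + - (a / \<omega>))))"
      using assms(1) unfolding arg by simp
  qed
qed

lemma orbit_harmonic:
  assumes orbit: "periodic_orbit oscillator k \<gamma> \<tau>"
    and near: "\<And>t i. \<bar>\<gamma> t $ i - of_int (m i)\<bar> < 1/4"
  shows "\<exists>A s. (\<forall>i. A i \<ge> 0) \<and>
    (\<forall>t i. \<gamma> t $ i - of_int (m i) = A i * cos (freq i * (t + s i))) \<and>
    k = (\<Sum>i\<in>UNIV. stiffness i * (A i)\<^sup>2 / 2)"
proof -
  have "\<exists>A s. A \<ge> 0 \<and> (\<forall>t. \<gamma> t $ i - of_int (m i) = A * cos (freq i * (t + s))) \<and>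
      (\<forall>t. velocity \<gamma> t $ i = - (A * freq i * sin (freq i * (t + s))))" for i
  proof (rule harmonic_motion[OF freq_pos])
    fix t
    have "(\<gamma> has_vector_derivative velocity \<gamma> t) (at t)"
      using orbit by (simp add: periodic_orbit_def euler_lagrange_def vector_derivative_works)
    from bounded_linear.has_vector_derivative[OF bounded_linear_vec_nth this, of i]
    show "((\<lambda>t. \<gamma> t $ i - of_int (m i)) has_real_derivative velocity \<gamma> t $ i) (at t)"
      unfolding has_real_derivative_iff_has_vector_derivative
      by (auto intro!: derivative_eq_intros)
    \<comment> \<open>Testing the Euler-Lagrange equation against a coordinate vector isolates one
      component: \<open>L_v\<close> gives its velocity, \<open>L_q\<close> its restoring
      force.\<close>
    have "((\<lambda>s. L_v oscillator (\<gamma> s) (velocity \<gamma> s) (axis i 1)) has_real_derivative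
        L_q oscillator (\<gamma> t) (velocity \<gamma> t) (axis i 1)) (at t)"
      using orbit by (simp add: periodic_orbit_def euler_lagrange_def)
    moreover have "L_q oscillator (\<gamma> t) (velocity \<gamma> t) (axis i 1) =
        - ((freq i)\<^sup>2 * (\<gamma> t $ i - of_int (m i)))"
      unfolding freq_squared
      by (simp add: L_q_near_equilibrium[OF near] axis_def if_distrib cong: if_cong)
    ultimately show "((\<lambda>t. velocity \<gamma> t $ i) has_real_derivative
        - ((freq i)\<^sup>2 * (\<gamma> t $ i - of_int (m i)))) (at t)"
      by (simp only: L_v_oscillator inner_axis inner_real_def mult_1_right)
  qed blast
  then obtain A s where A: "\<And>i. A i \<ge> 0"
    "\<And>t i. \<gamma> t $ i - of_int (m i) = A i * cos (freq i * (t + s i))"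
    "\<And>t i. velocity \<gamma> t $ i = - (A i * freq i * sin (freq i * (t + s i)))"
    by metis
  have "k = energy oscillator (\<gamma> 0) (velocity \<gamma> 0)"
    using orbit by (simp add: periodic_orbit_def)
  also have "\<dots> = (\<Sum>i\<in>UNIV. (velocity \<gamma> 0 $ i)\<^sup>2 / 2 + stiffness i * (\<gamma> 0 $ i - of_int (m i))\<^sup>2 / 2)"
    by (simp add: energy_oscillator potential_near_equilibrium[OF near] inner_vec_def
        sum.distrib sum_divide_distrib power2_eq_square)
  \<comment> \<open>The phases cancel: stiffness is the squared frequency, and sin^2 + cos^2 =
    1.\<close>
  also have "\<dots> = (\<Sum>i\<in>UNIV. stiffness i * (A i)\<^sup>2 / 2)"
    unfolding A(2,3) by (intro sum.cong)
      (auto simp: power_mult_distrib freq_squared sin_squared_eq algebra_simps add_divide_distrib diff_divide_distrib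
        simp del: real_sqrt_pow2_iff)
  finally show ?thesis
    using A(1,2) by blast
qed

section \<open>Irrationality of the frequency ratio\<close>

lemma square_eq_twice_square:
  fixes m n :: nat
  shows "m\<^sup>2 = 2 * n\<^sup>2 \<Longrightarrow> n = 0"
proof (induction n arbitrary: m rule: less_induct)
  case (less n)
  \<comment> \<open>Infinite descent: \<open>m\<close> and \<open>n\<close> are both even, and their
    halves solve the same equation with a smaller \<open>n\<close> unless \<open>n\<close> is
    0.\<close>
  then have "even m" by (metis dvd_triv_left even_power)
  then obtain a where a: "m = 2 * a" by blast
  with less.prems have a': "n\<^sup>2 = 2 * a\<^sup>2" by (simp add: power_mult_distrib)
  then have "even n" by (metis dvd_triv_left even_power)
  then obtain b where b: "n = 2 * b" by blast
  with a' have "a\<^sup>2 = 2 * b\<^sup>2" by (simp add: power_mult_distrib)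
  with less.IH[of b a] b show ?case by (cases "n = 0") auto
qed

text \<open>A common period would be both 2 pi n and 2 pi m / sqrt 2, making sqrt 2 the ratio m/n;
  hence n = 0 and the period vanishes.\<close>

lemma incommensurable_frequencies:
  assumes "\<tau> > 0" "\<And>i. \<exists>n::nat. freq i * \<tau> = real n * (2 * pi)"
  shows False
proof -
  from assms(2)[of 1] obtain n :: nat where n: "\<tau> = real n * (2 * pi)"
    by (auto simp: stiffness_def)
  from assms(2)[of 2] obtain m :: nat where "sqrt 2 * \<tau> = real m * (2 * pi)"
    by (auto simp: stiffness_def)
  with n have "sqrt 2 * real n = real m" by simp
  then have "(sqrt 2 * real n)\<^sup>2 = (real m)\<^sup>2" by simp
  then have "real (2 * n\<^sup>2) = real (m\<^sup>2)" by (simp add: power_mult_distrib)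
  then have "2 * n\<^sup>2 = m\<^sup>2" by (simp only: of_nat_eq_iff)
  then have "n = 0" using square_eq_twice_square[of m n] by simp
  with n assms(1) show False by simp
qed

section \<open>The normal modes\<close>

definition normal_mode :: "2 \<Rightarrow> real \<Rightarrow> real \<Rightarrow> real^2" where
  "normal_mode i k t = (sqrt (2 * k) / freq i * cos (freq i * t)) *\<^sub>R axis i 1"

abbreviation mode_period :: "2 \<Rightarrow> real" where
  "mode_period i \<equiv> 2 * pi / freq i"

text \<open>This amplitude A solves \<open>stiffness i\<close> * A^2 / 2 = \<open>k\<close>. It fits
  into the quadratic zone because sqrt (2/32) = 1/4 and every frequency is at least 1.\<close>

lemma mode_amplitude:
  assumes "0 < k" "k < 1/32"
  shows "0 < sqrt (2 * k) / freq i" "sqrt (2 * k) / freq i < 1/4"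
proof -
  have "sqrt (2 * k) < sqrt ((1/4)\<^sup>2)"
    using assms by (intro real_sqrt_less_mono) (simp add: power2_eq_square)
  then have "sqrt (2 * k) < 1/4" by simp
  moreover have "sqrt (2 * k) / freq i \<le> sqrt (2 * k) / 1"
    using freq_ge_1[of i] assms(1) by (intro divide_left_mono) auto
  ultimately show "sqrt (2 * k) / freq i < 1/4" by linarith
  show "0 < sqrt (2 * k) / freq i" using assms(1) freq_pos by simp
qed

lemma normal_mode_nth:
  "normal_mode i k t $ j = (if j = i then sqrt (2 * k) / freq i * cos (freq i * t) else 0)"
  by (simp add: normal_mode_def axis_def)

lemma sum_stiffness_single_linear:
  "(\<Sum>j\<in>UNIV. stiffness j * (if j = i then a else 0) * w $ j) = stiffness i * a * w $ i"
proof -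
  have "(\<Sum>j\<in>UNIV. stiffness j * (if j = i then a else 0) * w $ j) =
      (\<Sum>j\<in>UNIV. if j = i then stiffness j * a * w $ j else 0)"
    by (intro sum.cong) auto
  then show ?thesis by simp
qed

lemma sum_stiffness_single:
  "(\<Sum>j\<in>UNIV. stiffness j * (if j = i then a else 0)\<^sup>2 / 2) = stiffness i * a\<^sup>2 / 2"
proof -
  have "(\<Sum>j\<in>UNIV. stiffness j * (if j = i then a else 0)\<^sup>2 / 2) =
      (\<Sum>j\<in>UNIV. if j = i then stiffness j * a\<^sup>2 / 2 else 0)"
    by (intro sum.cong) auto
  then show ?thesis by simp
qed

lemma periodic_orbit_normal_mode:
  assumes "0 < k" "k < 1/32"
  shows "periodic_orbit oscillator k (normal_mode i k) (mode_period i)"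
proof -
  let ?x = "\<lambda>t. sqrt (2 * k) / freq i * cos (freq i * t)"
  let ?v = "\<lambda>t. - (sqrt (2 * k) * sin (freq i * t))"
  have f0: "freq i \<noteq> 0" using freq_pos[of i] by simp
  have "((\<lambda>t. b / c * cos (c * t)) has_real_derivative - (b * sin (c * t))) (at t)"
    if "c \<noteq> 0" for b c t :: real
    using that by (auto intro!: derivative_eq_intros)
  then have "(?x has_real_derivative ?v t) (at t)" for t
    using f0 .
  from has_vector_derivative_scaleR[OF this has_vector_derivative_const]
  have deriv: "(normal_mode i k has_vector_derivative (?v t *\<^sub>R axis i 1)) (at t)" for t
    unfolding normal_mode_def[abs_def] by simp
  then have vel: "velocity (normal_mode i k) t = ?v t *\<^sub>R axis i 1" for t
    by (rule vector_derivative_at)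
  have deriv2: "(?v has_real_derivative - (sqrt (2 * k) * freq i * cos (freq i * t))) (at t)" for t
    by (auto intro!: derivative_eq_intros)
  \<comment> \<open>The mode stays in the quadratic zone around the origin, so the explicit
    potential and force are valid all along it.\<close>
  have near: "\<bar>normal_mode i k t $ j - of_int 0\<bar> < 1/4" for t j
  proof -
    have "\<bar>?x t\<bar> \<le> sqrt (2 * k) / freq i * 1"
      unfolding abs_mult using mode_amplitude(1)[OF assms, of i]
      by (intro mult_mono) auto
    also have "\<dots> < 1/4" using mode_amplitude(2)[OF assms] by simp
    finally show ?thesis by (simp add: normal_mode_def axis_def)
  qed
  show ?thesis
    unfolding periodic_orbit_def euler_lagrange_def
  proof (intro conjI allI)
    show "mode_period i > 0" using freq_pos[of i] by simp
    fix t
    show "normal_mode i k differentiable (at t)"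
      using deriv by (rule differentiableI_vector)
    show "velocity (normal_mode i k) differentiable (at t)"
      unfolding vel by (rule differentiableI_vector)
        (rule has_vector_derivative_scaleR[OF deriv2 has_vector_derivative_const])
    show "normal_mode i k (t + mode_period i) - normal_mode i k t \<in> lattice"
      using f0 by (simp add: normal_mode_def lattice_def distrib_left)
    have "potential (normal_mode i k t) = stiffness i * (?x t)\<^sup>2 / 2"
      unfolding potential_near_equilibrium[OF near] of_int_0 diff_0_right normal_mode_nth
      by (rule sum_stiffness_single)
    moreover have "velocity (normal_mode i k) t \<bullet> velocity (normal_mode i k) t = (?v t)\<^sup>2"
      by (simp add: vel inner_axis_axis power2_eq_square)
    ultimately have "energy oscillator (normal_mode i k t) (velocity (normal_mode i k) t) =
        (?v t)\<^sup>2 / 2 + stiffness i * (?x t)\<^sup>2 / 2"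
      by (simp only: energy_oscillator)
    \<comment> \<open>Stiffness times squared amplitude is 2k, so kinetic and potential energy are k
      sin^2 and k cos^2.\<close>
    also have "\<dots> = k * ((sin (freq i * t))\<^sup>2 + (cos (freq i * t))\<^sup>2)"
      using assms(1) stiffness_pos[of i]
      by (simp add: power_mult_distrib power_divide distrib_left del: sin_cos_squared_add)
    also have "\<dots> = k" by simp
    finally show "energy oscillator (normal_mode i k t) (velocity (normal_mode i k) t) = k" .
  next
    fix t w
    have "L_q oscillator (normal_mode i k t) (velocity (normal_mode i k) t) w =
        - (stiffness i * ?x t * w $ i)"
      unfolding L_q_near_equilibrium[OF near] of_int_0 diff_0_right normal_mode_nth
      by (simp only: sum_stiffness_single_linear)
    also have "stiffness i * ?x t = sqrt (2 * k) * (stiffness i / freq i) * cos (freq i * t)"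
      by simp
    also have "stiffness i / freq i = freq i"
      by (rule real_div_sqrt) (rule less_imp_le[OF stiffness_pos])
    finally have L_q: "L_q oscillator (normal_mode i k t) (velocity (normal_mode i k) t) w =
        - (sqrt (2 * k) * freq i * cos (freq i * t)) * w $ i"
      by (simp only: mult_minus_left)
    have L_v: "L_v oscillator (normal_mode i k s) (velocity (normal_mode i k) s) w = ?v s * w $ i" for s
      by (simp add: L_v_oscillator vel inner_axis')
    show "((\<lambda>s. L_v oscillator (normal_mode i k s) (velocity (normal_mode i k) s) w)
        has_real_derivative L_q oscillator (normal_mode i k t) (velocity (normal_mode i k) t) w) (at t)"
      unfolding L_v L_q by (rule DERIV_cmult_right[OF deriv2])
  qed
qed

text \<open>At time \<open>- s\<close> the shifted mode \<open>i\<close> is at its maximum while the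
  \<open>i\<close>-th coordinate of mode \<open>j\<close> is 0. Equality modulo the lattice would
  make the amplitude an integer, but it lies strictly between 0 and 1/4.\<close>

lemma normal_modes_distinct:
  assumes "0 < k" "k < 1/32" "i \<noteq> j"
  shows "\<not> same_orbit (normal_mode i k) \<tau> (normal_mode j k) \<tau>'"
proof
  assume "same_orbit (normal_mode i k) \<tau> (normal_mode j k) \<tau>'"
  then obtain s where "normal_mode j k (- s) - normal_mode i k (- s + s) \<in> lattice"
    unfolding same_orbit_def by blast
  then have "(normal_mode j k (- s) - normal_mode i k 0) $ i \<in> \<int>"
    by (simp add: lattice_def)
  then have "sqrt (2 * k) / freq i \<in> \<int>"
    using assms(3) by (simp add: normal_mode_def axis_def)
  then obtain z where z: "sqrt (2 * k) / freq i = of_int z"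
    by (elim Ints_cases)
  have "0 < real_of_int z" "real_of_int z < 1/4"
    using mode_amplitude[OF assms(1,2), of i] unfolding z .
  then have "0 < z" "z < 1" by auto
  then show False by simp
qed

text \<open>Each coordinate of positive amplitude forces \<open>freq i * \<tau>\<close> to be a
  multiple of 2 pi. Incommensurability leaves only one such coordinate, and the energy fixes its
  amplitude.\<close>

lemma orbit_is_normal_mode:
  assumes orbit: "periodic_orbit oscillator k \<gamma> \<tau>" and k: "0 < k" "k < 1/32"
  obtains i where "same_orbit (normal_mode i k) (mode_period i) \<gamma> \<tau>"
proof -
  have \<tau>: "\<tau> > 0" using orbit by (simp add: periodic_orbit_def)
  obtain m :: "2 \<Rightarrow> int" where near: "\<And>t i. \<bar>\<gamma> t $ i - of_int (m i)\<bar> < 1/4"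
    using orbit_near_equilibrium[OF orbit k(2)] by metis
  obtain A s where A: "\<And>i. A i \<ge> 0"
    "\<And>t i. \<gamma> t $ i - of_int (m i) = A i * cos (freq i * (t + s i))"
    "k = (\<Sum>i\<in>UNIV. stiffness i * (A i)\<^sup>2 / 2)"
    using orbit_harmonic[OF orbit near] by blast
  have period: "\<exists>n::nat. freq i * \<tau> = real n * (2 * pi)" if "A i > 0" for i
  proof -
    \<comment> \<open>At this time the coordinate is at its maximum, so a return to the same value
      means that the cosine is 1 again.\<close>
    let ?t = "- s i"
    have "\<gamma> (?t + \<tau>) - \<gamma> ?t \<in> lattice"
      using orbit unfolding periodic_orbit_def by blast
    then have "\<gamma> (?t + \<tau>) $ i - \<gamma> ?t $ i \<in> \<int>"
      by (simp only: lattice_def mem_Collect_eq vector_minus_component)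
    \<comment> \<open>Both values lie within 1/4 of the same integer, so an integer difference
      vanishes: the coordinate closes up in the plane, not merely modulo 1.\<close>
    moreover have "\<bar>\<gamma> (?t + \<tau>) $ i - \<gamma> ?t $ i\<bar> < 1"
      using near[of "?t + \<tau>" i] near[of ?t i] by linarith
    ultimately have "\<gamma> (?t + \<tau>) $ i - \<gamma> ?t $ i = 0"
      by (rule Ints_nonzero_abs_less1)
    with A(2)[of "?t + \<tau>" i] A(2)[of ?t i] that have "cos (freq i * \<tau>) = 1"
      by simp
    then obtain n :: int where n: "freq i * \<tau> = of_int n * 2 * pi"
      by (auto simp: cos_one_2pi_int)
    moreover have "freq i * \<tau> > 0" using freq_pos \<tau> by simp
    ultimately have "n > 0" by (simp add: zero_less_mult_iff)
    with n show ?thesis by (intro exI[of _ "nat n"]) simp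
  qed
  have "\<exists>j. A j = 0"
  proof (rule ccontr)
    assume "\<not> ?thesis"
    then have "A i > 0" for i
      using A(1)[of i] by (simp add: less_le)
    then show False
      using incommensurable_frequencies[OF \<tau>] period by blast
  qed
  then obtain j where j: "A j = 0" ..
  define i :: 2 where "i = (if j = 1 then 2 else 1)"
  have i: "i \<noteq> j" "UNIV = {i, j}"
    using exhaust_2[of j] by (auto simp: i_def UNIV_2)
  from A(3) have "k = stiffness i * (A i)\<^sup>2 / 2"
    unfolding i(2) using i(1) j by simp
  then have "2 * k = (freq i * A i)\<^sup>2"
    using stiffness_pos[of i] by (simp add: power_mult_distrib)
  then have amp: "A i = sqrt (2 * k) / freq i"
    using A(1)[of i] freq_pos[of i] by (simp add: real_sqrt_mult)
  with k(1) have "A i > 0" using freq_pos[of i] by simp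
  then obtain n :: nat where n: "freq i * \<tau> = real n * (2 * pi)"
    using period by blast
  \<comment> \<open>Here \<tau> is \<open>n\<close> mode periods, the time shift is the phase
    \<open>s i\<close>, and what remains is the constant lattice vector \<open>m\<close>.\<close>
  have "same_orbit (normal_mode i k) (mode_period i) \<gamma> \<tau>"
    unfolding same_orbit_def
  proof (intro conjI exI allI)
    have "freq i * \<tau> > 0" using freq_pos \<tau> by simp
    with n show "1 \<le> n" by (cases n) auto
    show "real n * mode_period i = real 1 * \<tau>"
      using n freq_pos[of i] by (simp add: field_simps)
    fix t
    have "(\<gamma> t - normal_mode i k (t + s i)) $ l = of_int (m l)" for l
    proof -
      have "l = i \<or> l = j" using i(2) by auto
      then show ?thesis
        using A(2)[of t l] i(1) j amp by (auto simp: normal_mode_nth)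
    qed
    then show "\<gamma> t - normal_mode i k (t + s i) \<in> lattice"
      by (simp add: lattice_def)
  qed simp
  with that show thesis .
qed

section \<open>Translations decrease the action\<close>

text \<open>Both loops stay in the quadratic zone and have equal velocities, so the change of action
  is an exact expression in \<open>s\<close>, with no remainder to estimate.\<close>

lemma orbit_not_local_minimizer:
  assumes orbit: "periodic_orbit oscillator k \<gamma> \<tau>" and k: "0 < k" "k < 1/32"
  shows "\<not> local_minimizer oscillator k (\<lambda>t. \<gamma> (\<tau> * t)) \<tau>"
proof
  let ?\<Gamma> = "\<lambda>t. \<gamma> (\<tau> * t)"
  assume "local_minimizer oscillator k ?\<Gamma> \<tau>"
  then obtain \<epsilon> where W: "W12_loop ?\<Gamma>" and \<tau>: "\<tau> > 0" and \<epsilon>: "\<epsilon> > 0"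
    and min: "\<And>\<Delta>. W12_loop \<Delta> \<Longrightarrow> W12_dist ?\<Gamma> \<Delta> < \<epsilon> \<Longrightarrow>
      free_period_action oscillator k ?\<Gamma> \<tau> \<le> free_period_action oscillator k \<Delta> \<tau>"
    unfolding local_minimizer_def by (metis abs_zero diff_self)
  obtain m :: "2 \<Rightarrow> int" where near: "\<And>t i. \<bar>\<gamma> t $ i - of_int (m i)\<bar> < 1/4"
    using orbit_near_equilibrium[OF orbit k(2)] by metis
  define x where "x t = \<gamma> (\<tau> * t) $ 1 - of_int (m 1)" for t
  \<comment> \<open>Pointwise bounds below 1/4 leave no uniform room for a translation. Energy
    conservation gives the bound \<open>B\<close>, strictly below 1/4.\<close>
  define B where "B = sqrt (2 * k)"
  have B: "B < 1/4" using mode_amplitude(2)[OF k, of 1] by (simp add: B_def stiffness_def)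
  have energy: "(velocity \<gamma> t \<bullet> velocity \<gamma> t) / 2 + potential (\<gamma> t) = k" for t
    using orbit by (simp add: periodic_orbit_def energy_oscillator)
  have x_le: "\<bar>x t\<bar> \<le> B" for t
  proof -
    have "(x t)\<^sup>2 / 2 = well (\<gamma> (\<tau> * t) $ 1)"
      by (simp add: x_def well_near_int[OF near])
    also have "\<dots> \<le> potential (\<gamma> (\<tau> * t))" by (rule well_le_potential)
    also have "\<dots> \<le> (velocity \<gamma> (\<tau> * t) \<bullet> velocity \<gamma> (\<tau> * t)) / 2 + potential (\<gamma> (\<tau> * t))"
      by simp
    also have "\<dots> = k" by (rule energy)
    finally show ?thesis
      unfolding B_def by (intro real_le_rsqrt) simp
  qed
  define J where "J = (LINT t:{0..1}|lebesgue. x t)"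
  \<comment> \<open>Small enough to stay within W^{1,2} distance \<epsilon> and within the margin
    1/4 - \<open>B\<close> of the quadratic zone; the sign of \<open>s\<close> makes
    \<open>s * J\<close> nonnegative.\<close>
  define r where "r = min (\<epsilon> / 2) ((1/4 - B) / 2)"
  define s where "s = (if J \<ge> 0 then r else - r)"
  have r: "r > 0" "r < \<epsilon>" "r < 1/4 - B" using \<epsilon> B by (auto simp: r_def min_def)
  have s: "\<bar>s\<bar> = r" "s * J \<ge> 0"
    using r(1) by (auto simp: s_def mult_nonneg_nonneg mult_nonneg_nonpos)
  define \<Delta> where "\<Delta> t = \<gamma> (\<tau> * t) + s *\<^sub>R axis 1 1" for t
  have "(?\<Gamma> has_vector_derivative \<tau> *\<^sub>R velocity \<gamma> (\<tau> * t)) (at t)" for t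
  proof -
    have "(\<gamma> has_vector_derivative velocity \<gamma> (\<tau> * t)) (at (\<tau> * t))"
      using orbit by (simp add: periodic_orbit_def euler_lagrange_def vector_derivative_works)
    moreover have "((*) \<tau> has_vector_derivative \<tau>) (at t)"
      by (auto intro!: derivative_eq_intros)
    ultimately show ?thesis
      using vector_diff_chain_at[of "(*) \<tau>" \<tau> t \<gamma>] by (simp add: o_def)
  qed
  then have vel: "velocity ?\<Gamma> t = \<tau> *\<^sub>R velocity \<gamma> (\<tau> * t)"
      "velocity \<Delta> t = \<tau> *\<^sub>R velocity \<gamma> (\<tau> * t)" for t
    unfolding \<Delta>_def[abs_def]
    by (auto intro!: vector_derivative_at derivative_eq_intros)
  have W': "W12_loop \<Delta>"
    using W unfolding W12_loop_def vel by (auto simp: \<Delta>_def)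
  \<comment> \<open>The velocities agree, so only the L^2 norm of a constant vector of length |s|
    over the unit interval remains.\<close>
  have "W12_dist ?\<Gamma> \<Delta> = \<bar>s\<bar>"
    unfolding W12_dist_def vel by (simp add: \<Delta>_def set_lebesgue_integral_def)
  then have action_le: "free_period_action oscillator k ?\<Gamma> \<tau> \<le> free_period_action oscillator k \<Delta> \<tau>"
    using min[OF W'] s r by simp
  define F where "F t = oscillator (\<gamma> (\<tau> * t)) (velocity \<gamma> (\<tau> * t)) + k" for t
  define G where "G t = oscillator (\<Delta> t) (velocity \<gamma> (\<tau> * t)) + k" for t
  have cont: "continuous_on {0..1} (\<lambda>t. \<gamma> (\<tau> * t))"
    by (rule continuous_on_compose2[OF orbit_continuous[OF orbit, of UNIV]])
      (auto intro!: continuous_intros)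
  \<comment> \<open>Energy conservation eliminates the velocity: L + k = 2k - 2V. Integrability then
    follows from continuity of the orbit alone.\<close>
  have F_eq: "F t = 2 * k - (\<Sum>i\<in>UNIV. stiffness i * (\<gamma> (\<tau> * t) $ i - of_int (m i))\<^sup>2)" for t
    using energy[of "\<tau> * t"]
    by (simp add: F_def oscillator_def potential_near_equilibrium[OF near] flip: sum_divide_distrib)
  have F_int: "set_integrable lebesgue {0..1} F"
    unfolding F_eq[abs_def]
    by (intro absolutely_integrable_continuous_real continuous_intros cont)
  have x_int: "set_integrable lebesgue {0..1} x"
    unfolding x_def[abs_def]
    by (intro absolutely_integrable_continuous_real continuous_intros cont)
  have c_int: "set_integrable lebesgue {0..1} (\<lambda>t::real. s\<^sup>2 / 2)"
    by (intro absolutely_integrable_continuous_real continuous_intros)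
  have sx_int: "set_integrable lebesgue {0..1} (\<lambda>t. s * x t)"
    using x_int by simp
  \<comment> \<open>Only the first coordinate moves, and its stiffness is 1: (x + s)^2/2 - x^2/2 = s
    x + s^2/2.\<close>
  have G_eq: "G = (\<lambda>t. F t - s * x t - s\<^sup>2 / 2)"
  proof
    fix t
    have "\<bar>\<Delta> t $ i - of_int (m i)\<bar> < 1/4" for i
    proof (cases "i = 1")
      case True
      then have "\<Delta> t $ i - of_int (m i) = x t + s"
        by (simp add: \<Delta>_def x_def)
      then show ?thesis using x_le[of t] s(1) r(3) by linarith
    next
      case False
      then show ?thesis using near[of "\<tau> * t" i] by (simp add: \<Delta>_def axis_def)
    qed
    from potential_near_equilibrium[OF this] potential_near_equilibrium[OF near, of "\<tau> * t"]
    show "G t = F t - s * x t - s\<^sup>2 / 2"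
      by (simp add: G_def F_def oscillator_def UNIV_2 \<Delta>_def x_def axis_def stiffness_def
          power2_eq_square field_simps)
  qed
  \<comment> \<open>Integrability of \<open>F\<close> and \<open>G\<close> puts both actions in the
    finite branch of the definition, so they can be compared as reals and divided by \<tau>.\<close>
  have "set_integrable lebesgue {0..1} G"
    unfolding G_eq by (intro set_integral_diff F_int sx_int c_int)
  with F_int have "(LINT t:{0..1}|lebesgue. F t) \<le> (LINT t:{0..1}|lebesgue. G t)"
    using action_le \<tau> by (simp add: free_period_action_def vel F_def[abs_def] G_def[abs_def])
  also have "\<dots> = (LINT t:{0..1}|lebesgue. F t) - s * J - s\<^sup>2 / 2"
    unfolding G_eq J_def using F_int sx_int c_int
    by (simp add: set_integral_diff) (simp add: set_lebesgue_integral_def)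
  \<comment> \<open>Minimality would give 0 \<le> -sJ - s^2/2, while sJ \<ge> 0 and s is
    nonzero.\<close>
  finally have "s\<^sup>2 \<le> 0" using s(2) by linarith
  with s(1) r(1) show False by auto
qed

section \<open>The oscillator at energies just above its minimum\<close>

theorem mainTheorem3:
  shows "\<exists>L. tonelli L \<and> e0 L > min_energy L \<and>
    (\<forall>\<^sub>F k in at_right (min_energy L).
       (\<exists>\<gamma>\<^sub>1 \<tau>\<^sub>1 \<gamma>\<^sub>2 \<tau>\<^sub>2.
          periodic_orbit L k \<gamma>\<^sub>1 \<tau>\<^sub>1 \<and> periodic_orbit L k \<gamma>\<^sub>2 \<tau>\<^sub>2 \<and>
          \<not> same_orbit \<gamma>\<^sub>1 \<tau>\<^sub>1 \<gamma>\<^sub>2 \<tau>\<^sub>2 \<and>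
          (\<forall>\<gamma> \<tau>. periodic_orbit L k \<gamma> \<tau> \<longrightarrow>
             same_orbit \<gamma>\<^sub>1 \<tau>\<^sub>1 \<gamma> \<tau> \<or> same_orbit \<gamma>\<^sub>2 \<tau>\<^sub>2 \<gamma> \<tau>)) \<and>
       (\<forall>\<gamma> \<tau>. periodic_orbit L k \<gamma> \<tau> \<longrightarrow>
          \<not> local_minimizer L k (\<lambda>t. \<gamma> (\<tau> * t)) \<tau>))"
proof (intro exI[of _ oscillator] conjI)
  show "tonelli oscillator" by (rule tonelli_oscillator)
  show "min_energy oscillator < e0 oscillator"
    by (simp add: min_energy_oscillator e0_oscillator)
  \<comment> \<open>The minimal energy is 0, and 1/32 is the confinement threshold.\<close>
  have "\<forall>\<^sub>F k in at_right (0::real). k \<in> {0<..<1/32}"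
    by (rule eventually_at_right_real) simp
  then show "\<forall>\<^sub>F k in at_right (min_energy oscillator).
       (\<exists>\<gamma>\<^sub>1 \<tau>\<^sub>1 \<gamma>\<^sub>2 \<tau>\<^sub>2.
          periodic_orbit oscillator k \<gamma>\<^sub>1 \<tau>\<^sub>1 \<and> periodic_orbit oscillator k \<gamma>\<^sub>2 \<tau>\<^sub>2 \<and>
          \<not> same_orbit \<gamma>\<^sub>1 \<tau>\<^sub>1 \<gamma>\<^sub>2 \<tau>\<^sub>2 \<and>
          (\<forall>\<gamma> \<tau>. periodic_orbit oscillator k \<gamma> \<tau> \<longrightarrow>
             same_orbit \<gamma>\<^sub>1 \<tau>\<^sub>1 \<gamma> \<tau> \<or> same_orbit \<gamma>\<^sub>2 \<tau>\<^sub>2 \<gamma> \<tau>)) \<and>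
       (\<forall>\<gamma> \<tau>. periodic_orbit oscillator k \<gamma> \<tau> \<longrightarrow>
          \<not> local_minimizer oscillator k (\<lambda>t. \<gamma> (\<tau> * t)) \<tau>)"
    unfolding min_energy_oscillator
  proof eventually_elim
    case (elim k)
    then have k: "0 < k" "k < 1/32" by auto
    have modes: "same_orbit (normal_mode 1 k) (mode_period 1) \<gamma> \<tau> \<or>
        same_orbit (normal_mode 2 k) (mode_period 2) \<gamma> \<tau>"
      if orbit: "periodic_orbit oscillator k \<gamma> \<tau>" for \<gamma> \<tau>
    proof -
      obtain i where "same_orbit (normal_mode i k) (mode_period i) \<gamma> \<tau>"
        by (rule orbit_is_normal_mode[OF orbit k])
      moreover have "i = 1 \<or> i = 2" by (rule exhaust_2)
      ultimately show ?thesis by (elim disjE) simp_all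
    qed
    have distinct: "\<not> same_orbit (normal_mode 1 k) (mode_period 1) (normal_mode 2 k) (mode_period 2)"
      by (rule normal_modes_distinct[OF k]) simp
    show ?case
      by (intro conjI exI allI impI)
        (rule periodic_orbit_normal_mode[OF k] distinct modes orbit_not_local_minimizer[OF _ k];
          assumption?)+
  qed
qed

end
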